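(* Let $\mathcal{N}=(N,m_0,M_f)$ be a bounded, livelock-free labelled stochastic process (LSP), assumed complete, and let $F\subseteq M_f$ be non-empty. Then the outcome probability $\mathbb{P}_{\mathcal{N}}(F)=\sum_{\eta\text{ run of }\mathcal{N}\text{ ending in some }m\in F}\mathbb{P}_{\mathcal{N}}(\eta)$ is uniquely determined, and it equals the absorption probability of the set $F$ from the state $m_0$ in the absorbing Markov chain $\mathit{Chain}(\mathcal{N})$, i.e. $\sum_{w\text{ proper walk of }\mathit{Chain}(\mathcal{N})\text{ from }m_0\text{ to some state in }F}\mathbb{P}(w)$.
   Context: Fix a finite set $\mathcal{A}$ of task names and a silent label $\tau\notin\mathcal{A}$; $\Sigma=\mathcal{A}\cup\{\tau\}$. An LGSPN is $N=(Q,T,F_N,\ell,w)$ with finite disjoint sets $Q$ (places) and $T$ (transitions), flow relation $F_N\subseteq(Q\times T)\cup(T\times Q)$, labelling $\ell:T\to\Sigma$, $T$ partitioned into immediate transitions $T^{im}$ and timed transitions $T^{ti}$, and weights $w:T\to\mathbb{R}^{+}$. A marking is a multiset of places; ${}^\bullet t$ and $t^\bullet$ are the input and output places of $t$. $t$ is enabled in $m$ if ${}^\bullet t\le m$ and either $t\in T^{im}$ or no immediate $t'$ has ${}^\bullet t'\le m$; firing gives $m'=(m-{}^\bullet t)+t^\bullet$. A deadlock marking enables no transition. An LSP is $\mathcal{N}=(N,m_0,M_f)$ with $M_f$ a finite set of deadlock markings; it is complete if $M_f$ equals the set of deadlock markings reachable from $m_0$. A run is a finite sequence of transitions $t_0,\dots,t_n$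 fired successively from $m_0$ through markings $m_0,\dots,m_{n+1}$ with $m_{n+1}\in M_f$. The firing probability of $t$ in $m$ is $w(t)/\sum_{t'\text{ enabled in }m}w(t')$ if $t$ is enabled in $m$ and $0$ otherwise; the run probability $\mathbb{P}_{\mathcal{N}}(\eta)$ is the product of the firing probabilities of $t_i$ in $m_i$ along the run. The reachability graph $RG(\mathcal{N})$ has states the reachable markings, edges $(m,t,m')$ for firings (with the firing probability of $t$ in $m$), initial state $m_0$, final states the reachable markings in $M_f$. $\mathcal{N}$ is bounded if the number of tokens per place over reachable markings is bounded. A reachable marking is a livelock marking if it is not a deadlock and no firing sequence from it reaches a deadlock; livelock-free means no such marking. $\mathit{Chain}(\mathcal{N})$ is the Markov chain with states those of $RG(\mathcal{N})$, a transition for each edge of $RG(\mathcal{N})$ (labels dropped) with that edge's probability, plus a probability-$1$ self-loop on each final state. In a Markov chain, a walk is a sequence of states consecutive pairs of which are transitions, with probability the product of transition probabilities; in an absorbing Markov chain (states partitioned into absorbing states, whose only outgoing transition is a self-loop, and transient states, from which an absorbing state is reachable), a proper walk is a walk from a transient state to an absorbing state $v_f$ whose previous-to-last state differs from $v_f$. *)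

theory Defs
  imports "HOL-Analysis.Infinite_Sum" "HOL-Library.Multiset"
begin

text \<open>Labels have type \<open>'a option\<close>: \<open>None\<close> is the silent label and \<open>Some a\<close> the task name \<open>a\<close>.\<close>

record ('n, 'a) lgspn =
  places :: "'n set"
  transitions :: "'n set"
  flow :: "('n \<times> 'n) set"
  label :: "'n \<Rightarrow> 'a option"
  immediate :: "'n set"
  timed :: "'n set"
  weight :: "'n \<Rightarrow> real"

definition is_lgspn :: "'a set \<Rightarrow> ('n, 'a) lgspn \<Rightarrow> bool" where
  "is_lgspn A N \<longleftrightarrow>
     finite (places N) \<and> finite (transitions N) \<and> places N \<inter> transitions N = {} \<and>
     flow N \<subseteq> (places N \<times> transitions N) \<union> (transitions N \<times> places N) \<and>
     (\<forall>t\<in>transitions N. label N t \<in> insert None (Some ` A)) \<and>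
     immediate N \<union> timed N = transitions N \<and> immediate N \<inter> timed N = {} \<and>
     (\<forall>t\<in>transitions N. 0 < weight N t)"

type_synonym 'n marking = "'n multiset"

definition markings :: "('n, 'a) lgspn \<Rightarrow> 'n marking set" where
  "markings N = {m. set_mset m \<subseteq> places N}"

definition preset :: "('n, 'a) lgspn \<Rightarrow> 'n \<Rightarrow> 'n marking" where
  "preset N t = mset_set {q. (q, t) \<in> flow N}"

definition postset :: "('n, 'a) lgspn \<Rightarrow> 'n \<Rightarrow> 'n marking" where
  "postset N t = mset_set {q. (t, q) \<in> flow N}"

definition enabled :: "('n, 'a) lgspn \<Rightarrow> 'n marking \<Rightarrow> 'n \<Rightarrow> bool" where
  "enabled N m t \<longleftrightarrow>
     t \<in> transitions N \<and> preset N t \<subseteq># m \<and>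
     (t \<in> immediate N \<or> \<not> (\<exists>t'\<in>immediate N. preset N t' \<subseteq># m))"

definition fire :: "('n, 'a) lgspn \<Rightarrow> 'n marking \<Rightarrow> 'n \<Rightarrow> 'n marking" where
  "fire N m t = (m - preset N t) + postset N t"

definition deadlock :: "('n, 'a) lgspn \<Rightarrow> 'n marking \<Rightarrow> bool" where
  "deadlock N m \<longleftrightarrow> m \<in> markings N \<and> (\<forall>t. \<not> enabled N m t)"

fun firing_sequence :: "('n, 'a) lgspn \<Rightarrow> 'n marking \<Rightarrow> 'n list \<Rightarrow> 'n marking \<Rightarrow> bool" where
  "firing_sequence N m [] m' \<longleftrightarrow> m' = m"
| "firing_sequence N m (t # ts) m' \<longleftrightarrow> enabled N m t \<and> firing_sequence N (fire N m t) ts m'"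

definition reachable_from :: "('n, 'a) lgspn \<Rightarrow> 'n marking \<Rightarrow> 'n marking set" where
  "reachable_from N m = {m'. \<exists>ts. firing_sequence N m ts m'}"

definition firing_prob :: "('n, 'a) lgspn \<Rightarrow> 'n marking \<Rightarrow> 'n \<Rightarrow> real" where
  "firing_prob N m t =
     (if enabled N m t then weight N t / (\<Sum>t' | enabled N m t'. weight N t') else 0)"

fun sequence_prob :: "('n, 'a) lgspn \<Rightarrow> 'n marking \<Rightarrow> 'n list \<Rightarrow> real" where
  "sequence_prob N m [] = 1"
| "sequence_prob N m (t # ts) = firing_prob N m t * sequence_prob N (fire N m t) ts"

record ('n, 'a) lsp =
  net :: "('n, 'a) lgspn"
  initial :: "'n marking"
  finals :: "'n marking set"

definition is_lsp :: "'a set \<Rightarrow> ('n, 'a) lsp \<Rightarrow> bool" where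
  "is_lsp A S \<longleftrightarrow>
     is_lgspn A (net S) \<and> initial S \<in> markings (net S) \<and>
     finite (finals S) \<and> (\<forall>m\<in>finals S. deadlock (net S) m)"

definition reachable :: "('n, 'a) lsp \<Rightarrow> 'n marking set" where
  "reachable S = reachable_from (net S) (initial S)"

definition complete_lsp :: "('n, 'a) lsp \<Rightarrow> bool" where
  "complete_lsp S \<longleftrightarrow> finals S = {m \<in> reachable S. deadlock (net S) m}"

definition bounded_lsp :: "('n, 'a) lsp \<Rightarrow> bool" where
  "bounded_lsp S \<longleftrightarrow> (\<exists>k. \<forall>m\<in>reachable S. \<forall>q\<in>places (net S). count m q \<le> k)"

definition livelock :: "('n, 'a) lsp \<Rightarrow> 'n marking \<Rightarrow> bool" where
  "livelock S m \<longleftrightarrow>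
     m \<in> reachable S \<and> \<not> deadlock (net S) m \<and>
     \<not> (\<exists>m'\<in>reachable_from (net S) m. deadlock (net S) m')"

definition livelock_free :: "('n, 'a) lsp \<Rightarrow> bool" where
  "livelock_free S \<longleftrightarrow> \<not> (\<exists>m. livelock S m)"

text \<open>A run \<open>t\<^sub>0, \<dots>, t\<^sub>n\<close> has at least one transition. Hence there is no run if the initial
  marking is a deadlock, just as there is no proper walk from an absorbing state.\<close>

definition runs_to :: "('n, 'a) lsp \<Rightarrow> 'n marking set \<Rightarrow> 'n list set" where
  "runs_to S F =
     {ts. ts \<noteq> [] \<and> (\<exists>m\<in>finals S \<inter> F. firing_sequence (net S) (initial S) ts m)}"

definition run_prob :: "('n, 'a) lsp \<Rightarrow> 'n list \<Rightarrow> real" where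
  "run_prob S ts = sequence_prob (net S) (initial S) ts"

definition outcome_prob :: "('n, 'a) lsp \<Rightarrow> 'n marking set \<Rightarrow> real" where
  "outcome_prob S F = (\<Sum>\<^sub>\<infinity>\<eta>\<in>runs_to S F. run_prob S \<eta>)"

record 'n rgraph =
  rg_states :: "'n marking set"
  rg_edges :: "('n marking \<times> 'n \<times> 'n marking) set"
  rg_prob :: "'n marking \<times> 'n \<times> 'n marking \<Rightarrow> real"
  rg_initial :: "'n marking"
  rg_finals :: "'n marking set"

definition reachability_graph :: "('n, 'a) lsp \<Rightarrow> 'n rgraph" where
  "reachability_graph S = \<lparr>
     rg_states = reachable S,
     rg_edges = {(m, t, m'). m \<in> reachable S \<and> enabled (net S) m t \<and> m' = fire (net S) m t},
     rg_prob = (\<lambda>(m, t, m'). firing_prob (net S) m t),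
     rg_initial = initial S,
     rg_finals = reachable S \<inter> finals S\<rparr>"

record 's mchain =
  mc_states :: "'s set"
  mc_trans :: "('s \<times> 's) set"
  mc_prob :: "'s \<times> 's \<Rightarrow> real"

definition markov_chain :: "'s mchain \<Rightarrow> bool" where
  "markov_chain C \<longleftrightarrow>
     mc_trans C \<subseteq> mc_states C \<times> mc_states C \<and>
     (\<forall>e\<in>mc_trans C. 0 < mc_prob C e) \<and>
     (\<forall>u\<in>mc_states C. ((\<lambda>v. mc_prob C (u, v)) has_sum 1) {v. (u, v) \<in> mc_trans C})"

definition absorbing_states :: "'s mchain \<Rightarrow> 's set" where
  "absorbing_states C = {u \<in> mc_states C. {v. (u, v) \<in> mc_trans C} = {u}}"

definition transient_states :: "'s mchain \<Rightarrow> 's set" where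
  "transient_states C =
     {u \<in> mc_states C - absorbing_states C. \<exists>v\<in>absorbing_states C. (u, v) \<in> (mc_trans C)\<^sup>*}"

definition absorbing_markov_chain :: "'s mchain \<Rightarrow> bool" where
  "absorbing_markov_chain C \<longleftrightarrow>
     markov_chain C \<and> mc_states C = absorbing_states C \<union> transient_states C"

definition walk :: "'s mchain \<Rightarrow> 's list \<Rightarrow> bool" where
  "walk C us \<longleftrightarrow>
     us \<noteq> [] \<and> set us \<subseteq> mc_states C \<and>
     (\<forall>i. Suc i < length us \<longrightarrow> (us ! i, us ! Suc i) \<in> mc_trans C)"

definition walk_prob :: "'s mchain \<Rightarrow> 's list \<Rightarrow> real" where
  "walk_prob C us = (\<Prod>i<length us - 1. mc_prob C (us ! i, us ! Suc i))"

definition proper_walk :: "'s mchain \<Rightarrow> 's list \<Rightarrow> bool" where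
  "proper_walk C us \<longleftrightarrow>
     walk C us \<and> 2 \<le> length us \<and>
     hd us \<in> transient_states C \<and> last us \<in> absorbing_states C \<and>
     us ! (length us - 2) \<noteq> last us"

definition proper_walks_between :: "'s mchain \<Rightarrow> 's \<Rightarrow> 's set \<Rightarrow> 's list set" where
  "proper_walks_between C u F = {us. proper_walk C us \<and> hd us = u \<and> last us \<in> F}"

definition absorption_prob :: "'s mchain \<Rightarrow> 's \<Rightarrow> 's set \<Rightarrow> real" where
  "absorption_prob C u F = (\<Sum>\<^sub>\<infinity>us\<in>proper_walks_between C u F. walk_prob C us)"

text \<open>Several transitions of the net may lead from \<open>m\<close> to the same \<open>m'\<close>. Since walks of a Markov
  chain are sequences of states, these parallel edges become a single transition of the chain,
  whose probability is the sum of the probabilities of the edges.\<close>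

definition Chain :: "('n, 'a) lsp \<Rightarrow> 'n marking mchain" where
  "Chain S = (let G = reachability_graph S in \<lparr>
     mc_states = rg_states G,
     mc_trans = {(m, m'). \<exists>t. (m, t, m') \<in> rg_edges G} \<union> {(m, m) | m. m \<in> rg_finals G},
     mc_prob = (\<lambda>(m, m'). (\<Sum>t | (m, t, m') \<in> rg_edges G. rg_prob G (m, t, m'))
                  + (if m \<in> rg_finals G \<and> m' = m then 1 else 0))\<rparr>)"

end

theory Submission imports Defs begin

text \<open>Mapping a run to the sequence of markings that it visits sends the runs ending in \<open>F\<close> onto
  the proper walks from the initial marking to \<open>F\<close>. The fibre over a walk is finite, and since the
  probability of a transition of the chain is the sum over the parallel edges of the reachability
  graph, distributivity shows that the probabilities in the fibre add up to the probability of
  the walk. Grouping the sum over the runs by fibres gives the equality. The sum over the runs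
  converges because no run is a proper prefix of another one, so every finite partial sum is at
  most 1.\<close>

section \<open>Firing sequences\<close>

lemma enabled_subset_transitions: "{t. enabled N m t} \<subseteq> transitions N"
  by (auto simp: enabled_def)

lemma finite_enabled: "is_lgspn A N \<Longrightarrow> finite {t. enabled N m t}"
  by (rule finite_subset[OF enabled_subset_transitions]) (simp add: is_lgspn_def)

lemma weight_enabled_pos: "is_lgspn A N \<Longrightarrow> enabled N m t \<Longrightarrow> 0 < weight N t"
  by (auto simp: is_lgspn_def enabled_def)

lemma firing_prob_pos:
  assumes "is_lgspn A N" "enabled N m t"
  shows "0 < firing_prob N m t"
proof -
  have "0 < (\<Sum>t' | enabled N m t'. weight N t')"
    using assms finite_enabled[OF assms(1)] weight_enabled_pos[OF assms(1)]
    by (intro sum_pos) auto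
  then show ?thesis
    using assms weight_enabled_pos[OF assms] by (simp add: firing_prob_def)
qed

lemma firing_prob_nonneg: "is_lgspn A N \<Longrightarrow> 0 \<le> firing_prob N m t"
  using firing_prob_pos[of A N m t] by (cases "enabled N m t") (auto simp: firing_prob_def)

text \<open>One enabled transition makes the normalising total weight positive. In a marking that
  enables nothing the sum is empty, hence 0.\<close>

lemma sum_firing_prob:
  assumes "is_lgspn A N" "enabled N m t"
  shows "(\<Sum>t | enabled N m t. firing_prob N m t) = 1"
proof -
  have "0 < (\<Sum>t' | enabled N m t'. weight N t')"
    using assms finite_enabled[OF assms(1)] weight_enabled_pos[OF assms(1)]
    by (intro sum_pos) auto
  moreover have "(\<Sum>t | enabled N m t. firing_prob N m t)
      = (\<Sum>t | enabled N m t. weight N t / (\<Sum>t' | enabled N m t'. weight N t'))"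
    by (intro sum.cong) (auto simp: firing_prob_def)
  ultimately show ?thesis
    by (simp flip: sum_divide_distrib)
qed

lemma sequence_prob_nonneg: "is_lgspn A N \<Longrightarrow> 0 \<le> sequence_prob N m ts"
  by (induction ts arbitrary: m) (auto intro!: mult_nonneg_nonneg firing_prob_nonneg)

lemma firing_sequence_append:
  "firing_sequence N m (ts @ us) m' \<longleftrightarrow>
     (\<exists>m''. firing_sequence N m ts m'' \<and> firing_sequence N m'' us m')"
  by (induction ts arbitrary: m) auto

lemma fire_in_markings:
  assumes "is_lgspn A N" "m \<in> markings N" "enabled N m t"
  shows "fire N m t \<in> markings N"
proof -
  have "{q. (t, q) \<in> flow N} \<subseteq> places N"
    using assms by (auto simp: is_lgspn_def enabled_def)
  moreover from this have "finite {q. (t, q) \<in> flow N}"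
    using assms(1) finite_subset by (auto simp: is_lgspn_def)
  ultimately have "set_mset (postset N t) \<subseteq> places N"
    by (simp add: postset_def)
  then show ?thesis
    using assms(2) by (auto simp: markings_def fire_def dest: in_diffD)
qed

lemma firing_sequence_in_markings:
  assumes "is_lgspn A N"
  shows "firing_sequence N m ts m' \<Longrightarrow> m \<in> markings N \<Longrightarrow> m' \<in> markings N"
  by (induction ts arbitrary: m) (auto intro: fire_in_markings[OF assms])

text \<open>A deadlock ends a firing sequence, so these sequences are pairwise incomparable for the
  prefix order.\<close>

lemma sum_sequence_prob_to_deadlock_le_1:
  assumes "is_lgspn A N"
  shows "finite {ts. length ts \<le> n \<and> (\<exists>m'. firing_sequence N m ts m' \<and> deadlock N m')} \<and>
    (\<Sum>ts | length ts \<le> n \<and> (\<exists>m'. firing_sequence N m ts m' \<and> deadlock N m').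
       sequence_prob N m ts) \<le> 1"
    (is "finite (?D n m) \<and> _")
proof (induction n arbitrary: m)
  case 0
  have "?D 0 m = (if deadlock N m then {[]} else {})"
    by auto
  then show ?case
    by auto
next
  case (Suc n)
  show ?case
  proof (cases "\<exists>t. enabled N m t")
    case False
    then have "ts = []" if "firing_sequence N m ts m'" for ts m'
      using that by (cases ts) auto
    then have "?D (Suc n) m \<subseteq> {[]}"
      by auto
    then have "?D (Suc n) m = {} \<or> ?D (Suc n) m = {[]}"
      by (simp only: subset_singleton_iff)
    then show ?thesis
      by (elim disjE) (simp_all only: sum.empty, simp_all)
  next
    case True
    then obtain t\<^sub>0 where t\<^sub>0: "enabled N m t\<^sub>0"
      by blast
    let ?T = "{t. enabled N m t}"
    have fin: "finite ?T"
      by (rule finite_enabled[OF assms])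
    \<comment> \<open>Since \<open>m\<close> enables a transition, it is no deadlock. So the empty
      sequence drops out, and the others split disjointly by their first transition.\<close>
    have nil: "[] \<notin> ?D (Suc n) m"
      using t\<^sub>0 by (auto simp: deadlock_def)
    have D: "?D (Suc n) m = (\<Union>t\<in>?T. (#) t ` ?D n (fire N m t))"
    proof (intro set_eqI iffI)
      fix ts assume "ts \<in> ?D (Suc n) m"
      then show "ts \<in> (\<Union>t\<in>?T. (#) t ` ?D n (fire N m t))"
        using nil by (cases ts) auto
    qed auto
    have "(\<Sum>ts\<in>?D (Suc n) m. sequence_prob N m ts)
        = (\<Sum>t\<in>?T. \<Sum>ts\<in>(#) t ` ?D n (fire N m t). sequence_prob N m ts)"
      unfolding D using Suc.IH fin by (intro sum.UNION_disjoint) auto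
    also have "\<dots> = (\<Sum>t\<in>?T. firing_prob N m t * (\<Sum>ts\<in>?D n (fire N m t). sequence_prob N (fire N m t) ts))"
      by (intro sum.cong) (auto simp: sum.reindex sum_distrib_left)
    also have "\<dots> \<le> (\<Sum>t\<in>?T. firing_prob N m t)"
      using Suc.IH by (intro sum_mono mult_left_le firing_prob_nonneg[OF assms]) auto
    also have "\<dots> = 1"
      by (rule sum_firing_prob[OF assms t\<^sub>0])
    finally show ?thesis
      using Suc.IH fin D by simp
  qed
qed

lemma sequence_prob_summable_on_deadlocking:
  assumes "is_lgspn A N"
    and "\<And>ts. ts \<in> R \<Longrightarrow> \<exists>m'. firing_sequence N m ts m' \<and> deadlock N m'"
  shows "sequence_prob N m summable_on R"
proof (rule nonneg_bdd_above_summable_on)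
  show "0 \<le> sequence_prob N m ts" for ts
    by (rule sequence_prob_nonneg[OF assms(1)])
  have "sum (sequence_prob N m) X \<le> 1" if X: "X \<subseteq> R" "finite X" for X
  proof -
    \<comment> \<open>The inserted 0 keeps \<open>Max\<close> meaningful for empty \<open>X\<close>.
      A finite set of sequences has bounded length, so the bound for length at most \<open>n\<close>
      applies.\<close>
    define n where "n = Max (insert 0 (length ` X))"
    have "length ts \<le> n" if "ts \<in> X" for ts
      using that X(2) by (auto simp: n_def)
    then have "X \<subseteq> {ts. length ts \<le> n \<and> (\<exists>m'. firing_sequence N m ts m' \<and> deadlock N m')}"
      using X(1) assms(2) by blast
    then show ?thesis
      using sum_sequence_prob_to_deadlock_le_1[OF assms(1), of n m]
        sequence_prob_nonneg[OF assms(1), of m]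
      by (smt (verit) sum_mono2)
  qed
  then show "bdd_above (sum (sequence_prob N m) ` {X. X \<subseteq> R \<and> finite X})"
    by (auto intro!: bdd_aboveI[of _ 1])
qed

section \<open>Traces and their fibres\<close>

fun trace :: "('n, 'a) lgspn \<Rightarrow> 'n marking \<Rightarrow> 'n list \<Rightarrow> 'n marking list" where
  "trace N m [] = [m]"
| "trace N m (t # ts) = m # trace N (fire N m t) ts"

lemma trace_neq_Nil [simp]: "trace N m ts \<noteq> []"
  by (cases ts) auto

lemma hd_trace [simp]: "hd (trace N m ts) = m"
  by (cases ts) auto

lemma length_trace [simp]: "length (trace N m ts) = Suc (length ts)"
  by (induction ts arbitrary: m) auto

lemma last_trace: "firing_sequence N m ts m' \<Longrightarrow> last (trace N m ts) = m'"
  by (induction ts arbitrary: m) auto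

text \<open>Every visited marking except the last one fires a transition. Hence a run meets no final
  marking before its end.\<close>

lemma butlast_trace_enabled:
  "firing_sequence N m ts m' \<Longrightarrow> u \<in> set (butlast (trace N m ts)) \<Longrightarrow> \<exists>t. enabled N u t"
  by (induction ts arbitrary: m) auto

definition step_prob :: "('n, 'a) lgspn \<Rightarrow> 'n marking \<Rightarrow> 'n marking \<Rightarrow> real" where
  "step_prob N m m' = (\<Sum>t | enabled N m t \<and> fire N m t = m'. firing_prob N m t)"

text \<open>The recursive form of \<open>walk_prob\<close>. The step weight is a parameter so that
  \<open>mc_prob\<close> can be exchanged for \<open>step_prob\<close>.\<close>

fun path_prob :: "('s \<Rightarrow> 's \<Rightarrow> real) \<Rightarrow> 's list \<Rightarrow> real" where
  "path_prob p (u # v # us) = p u v * path_prob p (v # us)"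
| "path_prob p us = 1"

text \<open>A product of sums over parallel transitions expands into a sum over all choices of one
  transition per step. Finiteness is part of the induction because splitting the sum over a union
  needs it.\<close>

lemma sum_sequence_prob_fibre:
  assumes "is_lgspn A N"
  shows "finite {ts. firing_sequence N m ts (last (m # vs)) \<and> trace N m ts = m # vs} \<and>
    (\<Sum>ts | firing_sequence N m ts (last (m # vs)) \<and> trace N m ts = m # vs. sequence_prob N m ts)
      = path_prob (step_prob N) (m # vs)"
    (is "finite (?D m vs) \<and> _")
proof (induction vs arbitrary: m)
  case Nil
  have "ts = []" if "trace N m ts = [m]" for ts
    using that by (cases ts) auto
  then have "?D m [] = {[]}"
    by auto
  then show ?case
    by simp
next
  case (Cons v vs)
  let ?T = "{t. enabled N m t \<and> fire N m t = v}"
  have fin: "finite ?T"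
    by (rule finite_subset[OF _ finite_enabled[OF assms, of m]]) auto
  \<comment> \<open>The possible continuations depend only on \<open>v\<close>, not on the
    transition that led there, so their sum factors out below.\<close>
  have D: "?D m (v # vs) = (\<Union>t\<in>?T. (#) t ` ?D v vs)"
  proof (intro set_eqI iffI)
    fix ts assume ts: "ts \<in> ?D m (v # vs)"
    then obtain t ts' where [simp]: "ts = t # ts'"
      by (cases ts) auto
    from ts have "fire N m t = v"
      using hd_trace[of N "fire N m t" ts'] by (simp del: hd_trace)
    with ts show "ts \<in> (\<Union>t\<in>?T. (#) t ` ?D v vs)"
      by auto
  qed auto
  have "(\<Sum>ts\<in>?D m (v # vs). sequence_prob N m ts)
      = (\<Sum>t\<in>?T. \<Sum>ts\<in>(#) t ` ?D v vs. sequence_prob N m ts)"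
    unfolding D using Cons.IH fin by (intro sum.UNION_disjoint) auto
  also have "\<dots> = (\<Sum>t\<in>?T. firing_prob N m t * (\<Sum>ts\<in>?D v vs. sequence_prob N v ts))"
    by (intro sum.cong) (auto simp: sum.reindex sum_distrib_left)
  also have "\<dots> = step_prob N m v * path_prob (step_prob N) (v # vs)"
    by (simp only: conjunct2[OF Cons.IH] step_prob_def[of N m v] sum_distrib_right)
  finally show ?case
    using Cons.IH[of v] fin D by simp
qed

section \<open>Walks\<close>

lemma walk_singleton [simp]: "walk C [u] \<longleftrightarrow> u \<in> mc_states C"
  by (simp add: walk_def)

lemma walk_Cons_Cons [simp]:
  "walk C (u # v # us) \<longleftrightarrow> u \<in> mc_states C \<and> (u, v) \<in> mc_trans C \<and> walk C (v # us)"
  by (auto simp: walk_def nth_Cons split: nat.splits)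

lemma walk_prob_eq_path_prob: "walk_prob C us = path_prob (\<lambda>u v. mc_prob C (u, v)) us"
proof (induction "\<lambda>u v. mc_prob C (u, v)" us rule: path_prob.induct)
  case (1 u v us)
  have "walk_prob C (u # v # us) = mc_prob C (u, v) * walk_prob C (v # us)"
    by (simp add: walk_prob_def prod.lessThan_Suc_shift del: prod.lessThan_Suc)
  with 1 show ?case
    by simp
qed (simp_all add: walk_prob_def)

text \<open>Step weights are evaluated only at sources of steps, so the last state is exempt. This
  is essential: at a final marking \<open>mc_prob\<close> has a loop of weight 1, while
  \<open>step_prob\<close> vanishes.\<close>

lemma path_prob_cong:
  "(\<And>u v. u \<in> set (butlast us) \<Longrightarrow> p u v = q u v) \<Longrightarrow> path_prob p us = path_prob q us"
  by (induction p us rule: path_prob.induct) auto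

lemma nth_penultimate: "2 \<le> length us \<Longrightarrow> us ! (length us - 2) = last (butlast us)"
  by (subst last_conv_nth) (auto simp: nth_butlast numeral_2_eq_2 simp flip: length_greater_0_conv)

text \<open>Once in an absorbing state, a walk repeats it to the end, so its last two states would
  coincide. Thus the condition on the penultimate state of a proper walk controls all earlier
  states.\<close>

lemma walk_butlast_not_absorbing:
  "walk C us \<Longrightarrow> last (butlast us) \<noteq> last us \<Longrightarrow> u \<in> set (butlast us) \<Longrightarrow>
    u \<notin> absorbing_states C"
proof (induction us)
  case (Cons u' us)
  then obtain v vs where [simp]: "us = v # vs"
    by (cases us) auto
  have "u' \<in> absorbing_states C \<Longrightarrow> v = u'"
    using Cons.prems(1) by (auto simp: absorbing_states_def)
  with Cons show ?case
    by (cases vs) auto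
qed simp

section \<open>The chain of a process\<close>

lemma initial_reachable: "initial S \<in> reachable S"
  by (auto simp: reachable_def reachable_from_def intro: exI[of _ "[]"])

lemma reachable_firing_sequence:
  "m \<in> reachable S \<Longrightarrow> firing_sequence (net S) m ts m' \<Longrightarrow> m' \<in> reachable S"
  unfolding reachable_def reachable_from_def using firing_sequence_append by blast

lemma reachable_fire:
  "m \<in> reachable S \<Longrightarrow> enabled (net S) m t \<Longrightarrow> fire (net S) m t \<in> reachable S"
  by (rule reachable_firing_sequence[of _ _ "[t]"]) auto

lemma mc_states_Chain [simp]: "mc_states (Chain S) = reachable S"
  by (simp add: Chain_def reachability_graph_def)

locale complete_livelock_free_lsp =
  fixes A :: "'a set" and S :: "('n, 'a) lsp"
  assumes lsp: "is_lsp A S" and complete: "complete_lsp S" and livelock_free: "livelock_free S"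
begin

lemma lgspn: "is_lgspn A (net S)"
  using lsp by (simp add: is_lsp_def)

text \<open>Completeness turns finality of reachable markings into a local condition. The
  \<open>markings\<close> part of \<open>deadlock\<close> is preserved by firing.\<close>

lemma finals_iff: "m \<in> finals S \<longleftrightarrow> m \<in> reachable S \<and> (\<forall>t. \<not> enabled (net S) m t)"
proof -
  have "m \<in> markings (net S)" if "m \<in> reachable S"
    using that firing_sequence_in_markings[OF lgspn] lsp
    by (auto simp: reachable_def reachable_from_def is_lsp_def)
  then show ?thesis
    using complete by (auto simp: complete_lsp_def deadlock_def)
qed

lemma mc_trans_Chain:
  "(m, m') \<in> mc_trans (Chain S) \<longleftrightarrow> m \<in> reachable S \<and>
     ((\<exists>t. enabled (net S) m t \<and> m' = fire (net S) m t) \<or> m \<in> finals S \<and> m' = m)"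
  by (auto simp: Chain_def reachability_graph_def)

text \<open>The two summands of the chain probability never mix: a final marking has no outgoing
  edge, and loops are added only at final markings.\<close>

lemma mc_prob_Chain:
  assumes "m \<in> reachable S"
  shows "mc_prob (Chain S) (m, m') =
    (if m \<in> finals S then if m' = m then 1 else 0 else step_prob (net S) m m')"
proof (cases "m \<in> finals S")
  case True
  then have "\<not> enabled (net S) m t" for t
    by (simp add: finals_iff)
  with True assms show ?thesis
    by (simp add: Chain_def reachability_graph_def)
next
  case False
  with assms show ?thesis
    by (simp add: Chain_def reachability_graph_def step_prob_def eq_commute)
qed

lemma step_prob_pos:
  assumes "enabled (net S) m t" "fire (net S) m t = m'"
  shows "0 < step_prob (net S) m m'"
  unfolding step_prob_def
proof (rule sum_pos)
  show "finite {t'. enabled (net S) m t' \<and> fire (net S) m t' = m'}"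
    by (rule finite_subset[OF _ finite_enabled[OF lgspn, of m]]) auto
qed (use assms firing_prob_pos[OF lgspn] in auto)

section \<open>The chain is an absorbing Markov chain\<close>

lemma markov_chain_Chain: "markov_chain (Chain S)"
  unfolding markov_chain_def
proof (intro conjI ballI)
  show "mc_trans (Chain S) \<subseteq> mc_states (Chain S) \<times> mc_states (Chain S)"
    by (auto simp: mc_trans_Chain reachable_fire)
next
  fix e assume "e \<in> mc_trans (Chain S)"
  then show "0 < mc_prob (Chain S) e"
    by (cases e) (auto simp: mc_trans_Chain mc_prob_Chain finals_iff intro: step_prob_pos)
next
  fix m assume "m \<in> mc_states (Chain S)"
  then have m: "m \<in> reachable S"
    by simp
  let ?V = "{m'. (m, m') \<in> mc_trans (Chain S)}"
  show "((\<lambda>m'. mc_prob (Chain S) (m, m')) has_sum 1) ?V"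
  proof (cases "m \<in> finals S")
    case True
    then have "?V = {m}"
      by (auto simp: mc_trans_Chain finals_iff)
    with True m show ?thesis
      by (auto intro!: has_sum_finiteI simp: mc_prob_Chain)
  next
    case False
    let ?T = "{t. enabled (net S) m t}"
    from False m obtain t where t: "enabled (net S) m t"
      by (auto simp: finals_iff)
    have V: "?V = fire (net S) m ` ?T"
      using False m by (auto simp: mc_trans_Chain)
    have fin: "finite ?T"
      by (rule finite_enabled[OF lgspn])
    \<comment> \<open>Grouping the enabled transitions by their target marking reduces the row sum
      to the sum of all firing probabilities.\<close>
    have "(\<Sum>m'\<in>?V. mc_prob (Chain S) (m, m'))
        = (\<Sum>m'\<in>fire (net S) m ` ?T. \<Sum>t | t \<in> ?T \<and> fire (net S) m t = m'. firing_prob (net S) m t)"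
      using False m by (simp add: V mc_prob_Chain step_prob_def)
    also have "\<dots> = (\<Sum>t\<in>?T. firing_prob (net S) m t)"
      using fin by (intro sum.group) auto
    also have "\<dots> = 1"
      by (rule sum_firing_prob[OF lgspn t])
    finally show ?thesis
      using fin by (intro has_sum_finiteI) (auto simp: V)
  qed
qed

lemma firing_sequence_mc_trans:
  "firing_sequence (net S) m ts m' \<Longrightarrow> m \<in> reachable S \<Longrightarrow> (m, m') \<in> (mc_trans (Chain S))\<^sup>*"
proof (induction ts arbitrary: m)
  case (Cons t ts)
  then have "(m, fire (net S) m t) \<in> mc_trans (Chain S)"
    by (auto simp: mc_trans_Chain)
  moreover have "(fire (net S) m t, m') \<in> (mc_trans (Chain S))\<^sup>*"
    using Cons by (auto intro: reachable_fire)
  ultimately show ?case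
    by (rule converse_rtrancl_into_rtrancl)
qed simp

text \<open>Livelock-freeness provides a reachable deadlock, and completeness makes it final. This
  is the reachability that transient states require.\<close>

lemma ex_final_mc_trans:
  assumes "m \<in> reachable S"
  shows "\<exists>m'\<in>finals S. (m, m') \<in> (mc_trans (Chain S))\<^sup>*"
proof (cases "deadlock (net S) m")
  case True
  with assms complete show ?thesis
    by (auto simp: complete_lsp_def)
next
  case False
  with assms livelock_free obtain ts m'
    where "firing_sequence (net S) m ts m'" "deadlock (net S) m'"
    by (auto simp: livelock_free_def livelock_def reachable_from_def)
  moreover from this assms have "m' \<in> finals S"
    using complete by (auto simp: complete_lsp_def intro: reachable_firing_sequence)
  ultimately show ?thesis
    using firing_sequence_mc_trans assms by blast
qed

text \<open>Without livelock-freeness, a marking all of whose enabled transitions are self-loops would be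
  absorbing without being final.\<close>

lemma absorbing_states_Chain: "absorbing_states (Chain S) = finals S"
proof (intro set_eqI iffI)
  fix m assume "m \<in> absorbing_states (Chain S)"
  then have m: "m \<in> reachable S" and only: "\<And>v. (m, v) \<in> mc_trans (Chain S) \<Longrightarrow> v = m"
    by (auto simp: absorbing_states_def)
  \<comment> \<open>Nothing but \<open>m\<close> is reachable from an absorbing \<open>m\<close>, so
    the final marking reachable from it must be \<open>m\<close> itself.\<close>
  have "v = m" if "(m, v) \<in> (mc_trans (Chain S))\<^sup>*" for v
    using that by (induction rule: rtrancl_induct) (auto dest: only)
  with ex_final_mc_trans[OF m] show "m \<in> finals S"
    by auto
qed (auto simp: absorbing_states_def mc_trans_Chain finals_iff)

lemma transient_states_Chain: "transient_states (Chain S) = reachable S - finals S"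
  using ex_final_mc_trans by (auto simp: transient_states_def absorbing_states_Chain)

lemma absorbing_markov_chain_Chain: "absorbing_markov_chain (Chain S)"
  using markov_chain_Chain
  by (auto simp: absorbing_markov_chain_def absorbing_states_Chain transient_states_Chain finals_iff)

section \<open>Correspondence between runs and proper walks\<close>

lemma walk_trace:
  "firing_sequence (net S) m ts m' \<Longrightarrow> m \<in> reachable S \<Longrightarrow> walk (Chain S) (trace (net S) m ts)"
proof (induction ts arbitrary: m)
  case (Cons t ts)
  then have "walk (Chain S) (trace (net S) (fire (net S) m t) ts)"
    by (auto intro: reachable_fire)
  moreover obtain us where us: "trace (net S) (fire (net S) m t) ts = fire (net S) m t # us"
    by (metis hd_trace trace_neq_Nil list.collapse)
  ultimately show ?case
    using Cons.prems by (auto simp: mc_trans_Chain)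
qed simp

lemma trace_run_in_proper_walks:
  assumes "ts \<in> runs_to S F"
  shows "trace (net S) (initial S) ts \<in> proper_walks_between (Chain S) (initial S) F"
proof -
  let ?us = "trace (net S) (initial S) ts"
  obtain m where ts: "ts \<noteq> []" and m: "m \<in> finals S" "m \<in> F"
    and fs: "firing_sequence (net S) (initial S) ts m"
    using assms by (auto simp: runs_to_def)
  have len: "2 \<le> length ?us"
    using ts by (cases ts) auto
  have "butlast ?us \<noteq> []"
    using len by (auto simp flip: length_greater_0_conv)
  \<comment> \<open>The penultimate marking still enables a transition, whereas the last one is
    final, so the two differ.\<close>
  then have "last (butlast ?us) \<notin> finals S"
    using butlast_trace_enabled[OF fs last_in_set] by (auto simp: finals_iff)
  \<comment> \<open>A run has a first transition, which the initial marking enables. Hence the walk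
    starts in a transient state.\<close>
  moreover have "initial S \<notin> finals S"
    using ts fs by (cases ts) (auto simp: finals_iff)
  ultimately show ?thesis
    using walk_trace[OF fs initial_reachable] m len initial_reachable[of S]
    by (auto simp: proper_walks_between_def proper_walk_def last_trace[OF fs]
        nth_penultimate[OF len] absorbing_states_Chain transient_states_Chain
        simp del: length_trace)
qed

lemma sum_run_prob_fibre:
  assumes "us \<in> proper_walks_between (Chain S) (initial S) F"
  shows "finite {ts \<in> runs_to S F. trace (net S) (initial S) ts = us}"
    and "(\<Sum>ts | ts \<in> runs_to S F \<and> trace (net S) (initial S) ts = us. run_prob S ts)
      = walk_prob (Chain S) us"
proof -
  from assms have w: "walk (Chain S) us" and len: "2 \<le> length us" and hd: "hd us = initial S"
    and last: "last us \<in> finals S" "last us \<in> F" and pen: "last (butlast us) \<noteq> last us"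
    by (auto simp: proper_walks_between_def proper_walk_def absorbing_states_Chain nth_penultimate)
  obtain vs where us: "us = initial S # vs"
    using len hd by (cases us) auto
  \<comment> \<open>The trace determines the remaining run conditions: its length forces
    \<open>ts\<close> to be non-empty, and its last entry is the marking reached, which is final and
    in \<open>F\<close>.\<close>
  have fibre: "{ts. ts \<in> runs_to S F \<and> trace (net S) (initial S) ts = us} =
    {ts. firing_sequence (net S) (initial S) ts (last us) \<and> trace (net S) (initial S) ts = us}"
    using len last by (auto simp: runs_to_def last_trace)
  show "finite {ts \<in> runs_to S F. trace (net S) (initial S) ts = us}"
    unfolding fibre unfolding us using sum_sequence_prob_fibre[OF lgspn] by blast
  \<comment> \<open>At reachable non-final sources \<open>mc_prob\<close> agrees with
    \<open>step_prob\<close>.\<close>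
  have "u \<in> reachable S - finals S" if "u \<in> set (butlast us)" for u
    using walk_butlast_not_absorbing[OF w pen that] w in_set_butlastD[OF that]
    by (auto simp: absorbing_states_Chain walk_def)
  then have "walk_prob (Chain S) us = path_prob (step_prob (net S)) us"
    unfolding walk_prob_eq_path_prob by (intro path_prob_cong) (auto simp: mc_prob_Chain)
  then show "(\<Sum>ts | ts \<in> runs_to S F \<and> trace (net S) (initial S) ts = us. run_prob S ts)
      = walk_prob (Chain S) us"
    unfolding fibre run_prob_def
    using sum_sequence_prob_fibre[OF lgspn, of "initial S" vs] us by simp
qed

section \<open>Convergence and regrouping of the sum over runs\<close>

lemma run_prob_summable_on: "run_prob S summable_on runs_to S F"
  unfolding run_prob_def
  using lsp by (intro sequence_prob_summable_on_deadlocking[OF lgspn])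
    (auto simp: runs_to_def is_lsp_def)

lemma has_sum_walk_prob:
  assumes "(run_prob S has_sum p) (runs_to S F)"
  shows "(walk_prob (Chain S) has_sum p) (proper_walks_between (Chain S) (initial S) F)"
proof -
  let ?W = "proper_walks_between (Chain S) (initial S) F"
  let ?B = "\<lambda>us. {ts \<in> runs_to S F. trace (net S) (initial S) ts = us}"
  \<comment> \<open>Each run lies in exactly one fibre, that of its trace. Summing over pairs of a
    walk and a run in its fibre, inner sums first, then leaves the walk probabilities.\<close>
  have "bij_betw snd (Sigma ?W ?B) (runs_to S F)"
    by (rule bij_betw_byWitness[where f' = "\<lambda>ts. (trace (net S) (initial S) ts, ts)"])
      (auto simp: trace_run_in_proper_walks)
  then have "((\<lambda>x. run_prob S (snd x)) has_sum p) (Sigma ?W ?B)"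
    using assms by (simp add: has_sum_reindex_bij_betw)
  then show ?thesis
    by (rule has_sum_Sigma') (auto intro!: has_sum_finiteI simp: sum_run_prob_fibre)
qed

end

theorem theorem2:
  fixes A :: "'a set" and S :: "('n, 'a) lsp" and F :: "'n marking set"
  assumes "finite A"
    and "is_lsp A S"
    and "complete_lsp S"
    and "bounded_lsp S"
    and "livelock_free S"
    and "F \<subseteq> finals S"
    and "F \<noteq> {}"
  shows "absorbing_markov_chain (Chain S) \<and>
    (\<exists>!p. (run_prob S has_sum p) (runs_to S F)) \<and>
    walk_prob (Chain S) summable_on proper_walks_between (Chain S) (initial S) F \<and>
    outcome_prob S F = absorption_prob (Chain S) (initial S) F"
proof -
  interpret complete_livelock_free_lsp A S
    using assms by unfold_locales
  \<comment> \<open>An infinite sum without convergence defaults to 0, so summability is what makes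
    \<open>outcome_prob\<close> a genuine limit. The regrouping then carries convergence and value
    over to the walks.\<close>
  have run: "(run_prob S has_sum outcome_prob S F) (runs_to S F)"
    unfolding outcome_prob_def by (rule has_sum_infsum[OF run_prob_summable_on])
  note walk = has_sum_walk_prob[OF run]
  have "\<exists>!p. (run_prob S has_sum p) (runs_to S F)"
    using run has_sum_unique by blast
  moreover have "outcome_prob S F = absorption_prob (Chain S) (initial S) F"
    unfolding absorption_prob_def using infsumI[OF walk] by simp
  ultimately show ?thesis
    using absorbing_markov_chain_Chain has_sum_imp_summable[OF walk] by blast
qed

end
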